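(* For $n\ge3$, the posets $\mathcal{FL}yn_n^w$ and $\mathcal{SF}_n$ are not isomorphic.
   Context: $\mathcal{SF}_n$ is the poset of rooted spanning forests on vertex set $[n]$ (forests of rooted trees whose vertex set is $[n]$), with $F\lessdot F'$ iff $F'$ is obtained from $F$ by joining the roots of two of its trees by an edge and declaring one of these two roots to be the root of the new tree; its minimum is the forest of $n$ isolated rooted vertices. Trees: a bicolored binary forest on $[n]$ is a forest of rooted planar binary trees (left child $L(v)$, right child $R(v)$) with leaves bijectively labeled by $[n]$ and internal vertices colored in $\{0,1\}$. $\nu(v)$ is the smallest leaf label below $v$; normalized means $\nu(v)=\nu(L(v))$ for all internal $v$; $v$ is Lyndon if $L(v)$ is a leaf or $\nu(R(L(v)))>\nu(R(v))$. A normalized tree is a bicolored Lyndon tree if every internal $v$ whose left child is internal is Lyndon or satisfies $\mathrm{color}(L(v))>\mathrm{color}(v)$. To $u$-merge two bicolored Lyndon trees $T_1,T_2$ (min leaf of $T_1$ smaller), create a new vertex $r$ of color $u$ with left child the root of $T_1$ and right child the root of $T_2$; while the result is not a bicolored Lyndon tree, replace the subtree $r(x(X_L,X_R),Y)$ by $x(r(X_L,Y),X_R)$, colors kept. $\mathcal{FL}yn_n^w$ is the set of forests on $[n]$ whose components are bicolored Lyndon trees, with $F\lessdot F'$ iff $F'$ arises from $F$ by $u$-merging exactly two trees, $u\in\{0,1\}$. *)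

theory Defs
  imports Main "HOL-Library.While_Combinator" "HOL-Library.Disjoint_Sets"
begin

section \<open>Posets given by a carrier and a covering relation\<close>

definition order_of_covers :: "'a set \<Rightarrow> 'a rel \<Rightarrow> 'a rel" where
  "order_of_covers A c = Restr (c\<^sup>*) A"

definition poset_isomorphic :: "'a set \<Rightarrow> 'a rel \<Rightarrow> 'b set \<Rightarrow> 'b rel \<Rightarrow> bool" where
  "poset_isomorphic A r B s \<longleftrightarrow>
     (\<exists>f. bij_betw f A B \<and> (\<forall>x\<in>A. \<forall>y\<in>A. (x, y) \<in> r \<longleftrightarrow> (f x, f y) \<in> s))"

lemma partial_order_on_order_of_covers:
  fixes rk :: "'a \<Rightarrow> nat"
  assumes "\<And>x y. (x, y) \<in> c \<Longrightarrow> rk y < rk x"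
  shows "partial_order_on A (order_of_covers A c)"
proof -
  have less: "rk y < rk x" if "(x, y) \<in> c\<^sup>+" for x y
    using that by induction (auto dest: assms)
  have "antisym (c\<^sup>*)"
  proof (rule antisymI)
    fix x y assume xy: "(x, y) \<in> c\<^sup>*" and yx: "(y, x) \<in> c\<^sup>*"
    show "x = y"
    proof (rule ccontr)
      assume "x \<noteq> y"
      with xy yx have "(x, y) \<in> c\<^sup>+" "(y, x) \<in> c\<^sup>+" by (auto simp: rtrancl_eq_or_trancl)
      then show False using less[of x y] less[of y x] by simp
    qed
  qed
  then have "antisym (order_of_covers A c)"
    unfolding order_of_covers_def antisym_def by blast
  moreover have "trans (order_of_covers A c)"
    unfolding order_of_covers_def by (intro trans_Restr trans_rtrancl)
  moreover have "refl_on A (order_of_covers A c)"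
    by (simp add: order_of_covers_def refl_on_def)
  moreover have "order_of_covers A c \<subseteq> A \<times> A"
    by (simp add: order_of_covers_def)
  ultimately show ?thesis
    by (simp add: partial_order_on_def preorder_on_def)
qed

section \<open>Rooted spanning forests\<close>

definition reachable :: "'v set set \<Rightarrow> 'v \<Rightarrow> 'v \<Rightarrow> bool" where
  "reachable E u v \<longleftrightarrow> (u, v) \<in> {(x, y). {x, y} \<in> E}\<^sup>*"

definition is_cycle :: "'v set set \<Rightarrow> 'v list \<Rightarrow> bool" where
  "is_cycle E p \<longleftrightarrow> 3 \<le> length p \<and> distinct p \<and>
     (\<forall>i<length p. {p ! i, p ! (Suc i mod length p)} \<in> E)"

text \<open>A rooted forest is a pair of its edge set and its set of roots.\<close>

type_synonym rooted_forest = "nat set set \<times> nat set"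

definition rooted_spanning_forests :: "nat \<Rightarrow> rooted_forest set" where
  "rooted_spanning_forests n =
     {(E, R). (\<forall>e\<in>E. e \<subseteq> {1..n} \<and> card e = 2) \<and>
              (\<nexists>p. is_cycle E p) \<and>
              R \<subseteq> {1..n} \<and>
              (\<forall>v\<in>{1..n}. \<exists>!r. r \<in> R \<and> reachable E v r)}"

text \<open>As \<open>r\<close> and \<open>s\<close> range over ordered pairs of roots, either of the two may
  become the root of the new tree.\<close>

definition SF_cover :: "nat \<Rightarrow> rooted_forest rel" where
  "SF_cover n = {((E, R), (E', R')).
     (E, R) \<in> rooted_spanning_forests n \<and> (E', R') \<in> rooted_spanning_forests n \<and>
     (\<exists>r\<in>R. \<exists>s\<in>R. r \<noteq> s \<and> E' = insert {r, s} E \<and> R' = R - {s})}"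

definition SF_order :: "nat \<Rightarrow> rooted_forest rel" where
  "SF_order n = order_of_covers (rooted_spanning_forests n) (SF_cover n)"

lemma partial_order_on_SF: "partial_order_on (rooted_spanning_forests n) (SF_order n)"
  unfolding SF_order_def
proof (rule partial_order_on_order_of_covers[where rk = "\<lambda>F. card (snd F)"])
  fix F F' assume "(F, F') \<in> SF_cover n"
  then obtain s where "s \<in> snd F" "snd F' = snd F - {s}" "snd F \<subseteq> {1..n}"
    unfolding SF_cover_def rooted_spanning_forests_def by auto
  then show "card (snd F') < card (snd F)"
    by (metis card_Diff1_less finite_atLeastAtMost finite_subset)
qed

section \<open>Forests of bicolored Lyndon trees\<close>

text \<open>The colors 0 and 1 are represented by \<^const>\<open>False\<close> and \<^const>\<open>True\<close>; recall
  that \<^prop>\<open>False < True\<close>.\<close>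

datatype btree = Leaf nat | Node (color: bool) btree btree

fun leaves :: "btree \<Rightarrow> nat list" where
  "leaves (Leaf a) = [a]"
| "leaves (Node c l r) = leaves l @ leaves r"

text \<open>A vertex is represented by the subtree below it; this is unambiguous when the leaf
  labels are distinct.\<close>

fun subtrees :: "btree \<Rightarrow> btree set" where
  "subtrees (Leaf a) = {Leaf a}"
| "subtrees (Node c l r) = insert (Node c l r) (subtrees l \<union> subtrees r)"

definition nu :: "btree \<Rightarrow> nat" where
  "nu t = Min (set (leaves t))"

definition normalized :: "btree \<Rightarrow> bool" where
  "normalized t \<longleftrightarrow> (\<forall>c l r. Node c l r \<in> subtrees t \<longrightarrow> nu (Node c l r) = nu l)"

text \<open>The Lyndon condition for an internal vertex with children \<open>l\<close> and \<open>r\<close>.\<close>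

definition lyndon_vertex :: "btree \<Rightarrow> btree \<Rightarrow> bool" where
  "lyndon_vertex l r \<longleftrightarrow> (case l of Leaf a \<Rightarrow> True | Node d ll lr \<Rightarrow> nu lr > nu r)"

definition bicolored_lyndon :: "btree \<Rightarrow> bool" where
  "bicolored_lyndon t \<longleftrightarrow> normalized t \<and>
     (\<forall>c l r. Node c l r \<in> subtrees t \<and> (\<nexists>a. l = Leaf a) \<longrightarrow>
        lyndon_vertex l r \<or> color l > c)"

definition bicolored_binary_forests :: "nat \<Rightarrow> btree set set" where
  "bicolored_binary_forests n =
     {F. finite F \<and> (\<forall>T\<in>F. distinct (leaves T)) \<and>
         disjoint_family_on (\<lambda>T. set (leaves T)) F \<and>
         (\<Union>T\<in>F. set (leaves T)) = {1..n}}"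

text \<open>One replacement of \<open>r(x(X\<^sub>L, X\<^sub>R), Y)\<close> by \<open>x(r(X\<^sub>L, Y), X\<^sub>R)\<close>, where \<open>r\<close> is the vertex
  reached from the root by descending \<open>k\<close> times to the left child. The last equation covers
  the positions where no replacement is possible.\<close>

fun slide :: "nat \<Rightarrow> btree \<Rightarrow> btree" where
  "slide 0 (Node u (Node c xl xr) y) = Node c (Node u xl y) xr"
| "slide (Suc k) (Node c l r) = Node c (slide k l) r"
| "slide _ t = t"

text \<open>Each replacement moves the new vertex one step down to the left, so the loop state
  pairs the current tree with the depth of the new vertex.\<close>

definition merge :: "bool \<Rightarrow> btree \<Rightarrow> btree \<Rightarrow> btree" where
  "merge u T1 T2 =
     snd (while (\<lambda>(k, t). \<not> bicolored_lyndon t) (\<lambda>(k, t). (Suc k, slide k t)) (0, Node u T1 T2))"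

definition lyndon_forests :: "nat \<Rightarrow> btree set set" where
  "lyndon_forests n = {F \<in> bicolored_binary_forests n. \<forall>T\<in>F. bicolored_lyndon T}"

definition FLyn_cover :: "nat \<Rightarrow> btree set rel" where
  "FLyn_cover n = {(F, F'). F \<in> lyndon_forests n \<and> F' \<in> lyndon_forests n \<and>
     (\<exists>T1\<in>F. \<exists>T2\<in>F. \<exists>u. nu T1 < nu T2 \<and> F' = insert (merge u T1 T2) (F - {T1, T2}))}"

definition FLyn_order :: "nat \<Rightarrow> btree set rel" where
  "FLyn_order n = order_of_covers (lyndon_forests n) (FLyn_cover n)"

lemma partial_order_on_FLyn: "partial_order_on (lyndon_forests n) (FLyn_order n)"
  unfolding FLyn_order_def
proof (rule partial_order_on_order_of_covers[where rk = card])
  fix F F' assume "(F, F') \<in> FLyn_cover n"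
  then have "finite F"
    and "\<exists>T1\<in>F. \<exists>T2\<in>F. \<exists>u. nu T1 < nu T2 \<and> F' = insert (merge u T1 T2) (F - {T1, T2})"
    unfolding FLyn_cover_def lyndon_forests_def bicolored_binary_forests_def by simp_all
  then obtain T1 T2 T where fin: "finite F" and T: "T1 \<in> F" "T2 \<in> F" "T1 \<noteq> T2"
    and F': "F' = insert T (F - {T1, T2})"
    by blast
  have "card (F - {T1, T2}) = card F - 2" using fin T by (simp add: card_Diff_subset)
  moreover have "2 \<le> card F" using fin T card_mono[of F "{T1, T2}"] by simp
  moreover have "card F' \<le> Suc (card (F - {T1, T2}))" unfolding F' using fin by (simp add: card_insert_if)
  ultimately show "card F' < card F" by linarith
qed

end

theory Submission
  imports Defs
begin

text \<open>Both covering relations lower a rank by exactly one, so an isomorphism of the posets is an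
  isomorphism of the covering digraphs. The forest of \<open>n\<close> single leaves has \<open>n(n - 1)\<close> upper
  covers; a rooted forest with \<open>k\<close> roots has at most \<open>k(k - 1)\<close>, so an isomorphism preserves the
  minimum. Now count the atoms having a common upper cover with a given atom: for the atom
  \<open>[n-1, n]\<close> of color 0 these are at most the \<open>(n - 2)(n - 3)\<close> atoms merging two labels
  below \<open>n - 1\<close>, whereas an edge from a root \<open>r\<close> to a leaf \<open>s\<close> is compatible with all
  \<open>(n - 2)(n - 3)\<close> oriented edges avoiding \<open>r\<close> and \<open>s\<close>, and also with the other edges at the
  root \<open>r\<close>.\<close>

section \<open>Isomorphisms and covering relations\<close>

lemma rank_less_trancl:
  fixes rk :: "'a \<Rightarrow> nat"
  assumes "\<And>x y. (x, y) \<in> c \<Longrightarrow> rk x = Suc (rk y)" and "(x, y) \<in> c\<^sup>+"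
  shows "rk y < rk x"
  using assms(2) by induction (auto dest: assms(1))

text \<open>Each pair of \<open>c\<close> lowers the rank by exactly one, so nothing fits strictly
  between its members, and \<open>c\<close> can be recovered from the order alone.\<close>

lemma cover_iff_order_of_covers:
  fixes rk :: "'a \<Rightarrow> nat"
  assumes rk: "\<And>x y. (x, y) \<in> c \<Longrightarrow> rk x = Suc (rk y)"
    and sub: "c \<subseteq> A \<times> A" and "x \<in> A" "y \<in> A"
  shows "(x, y) \<in> c \<longleftrightarrow> (x, y) \<in> order_of_covers A c \<and> x \<noteq> y \<and>
    (\<forall>z\<in>A. (x, z) \<in> order_of_covers A c \<and> (z, y) \<in> order_of_covers A c \<longrightarrow> z = x \<or> z = y)"
    (is "?L \<longleftrightarrow> ?R")
proof
  assume L: ?L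
  have "z = x \<or> z = y" if "(x, z) \<in> c\<^sup>*" "(z, y) \<in> c\<^sup>*" for z
  proof (rule ccontr)
    assume "\<not> (z = x \<or> z = y)"
    with that have "(x, z) \<in> c\<^sup>+" "(z, y) \<in> c\<^sup>+" by (auto simp: rtrancl_eq_or_trancl)
    then have "rk z < rk x" "rk y < rk z" using rank_less_trancl[of c rk, OF rk] by blast+
    with rk[OF L] show False by simp
  qed
  moreover have "x \<noteq> y" using rk[OF L] by auto
  ultimately show ?R using L assms by (auto simp: order_of_covers_def)
next
  assume R: ?R
  then have "(x, y) \<in> c\<^sup>*" "x \<noteq> y" by (auto simp: order_of_covers_def)
  then obtain z where z: "(x, z) \<in> c" "(z, y) \<in> c\<^sup>*" by (meson converse_rtranclE)
  then have "z \<in> A" "z \<noteq> x" using sub rk[OF z(1)] by auto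
  then have "z = y" using R z assms by (auto simp: order_of_covers_def)
  with z show ?L by simp
qed

lemma poset_isomorphic_covers:
  fixes rk :: "'a \<Rightarrow> nat" and rk' :: "'b \<Rightarrow> nat"
  assumes rk: "\<And>x y. (x, y) \<in> c \<Longrightarrow> rk x = Suc (rk y)" and c: "c \<subseteq> A \<times> A"
    and rk': "\<And>x y. (x, y) \<in> d \<Longrightarrow> rk' x = Suc (rk' y)" and d: "d \<subseteq> B \<times> B"
    and iso: "poset_isomorphic A (order_of_covers A c) B (order_of_covers B d)"
  obtains f where "bij_betw f A B" "\<And>x y. x \<in> A \<Longrightarrow> y \<in> A \<Longrightarrow> (x, y) \<in> c \<longleftrightarrow> (f x, f y) \<in> d"
proof -
  obtain f where f: "bij_betw f A B"
    and ord: "\<And>x y. x \<in> A \<Longrightarrow> y \<in> A \<Longrightarrow>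
      (x, y) \<in> order_of_covers A c \<longleftrightarrow> (f x, f y) \<in> order_of_covers B d"
    using iso unfolding poset_isomorphic_def by blast
  have inj: "f x = f y \<longleftrightarrow> x = y" if "x \<in> A" "y \<in> A" for x y
    using f that by (auto simp: bij_betw_def inj_on_def)
  have B: "B = f ` A" using f by (simp add: bij_betw_def)
  have "(x, y) \<in> c \<longleftrightarrow> (f x, f y) \<in> d" if xy: "x \<in> A" "y \<in> A" for x y
  proof -
    have fxy: "f x \<in> B" "f y \<in> B" using xy B by auto
    \<comment> \<open>As \<open>f\<close> is onto \<open>B\<close>, betweenness in \<open>B\<close>
      can be tested on images of points of \<open>A\<close>.\<close>
    have ball: "(\<forall>z\<in>B. Q z) \<longleftrightarrow> (\<forall>z\<in>A. Q (f z))" for Q by (simp add: B)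
    have "(x, y) \<in> c \<longleftrightarrow> (x, y) \<in> order_of_covers A c \<and> x \<noteq> y \<and>
      (\<forall>z\<in>A. (x, z) \<in> order_of_covers A c \<and> (z, y) \<in> order_of_covers A c \<longrightarrow> z = x \<or> z = y)"
      by (rule cover_iff_order_of_covers[of c rk]) (use rk c xy in auto)
    moreover have "(f x, f y) \<in> d \<longleftrightarrow> (f x, f y) \<in> order_of_covers B d \<and> f x \<noteq> f y \<and>
      (\<forall>z\<in>B. (f x, z) \<in> order_of_covers B d \<and> (z, f y) \<in> order_of_covers B d
        \<longrightarrow> z = f x \<or> z = f y)"
      by (rule cover_iff_order_of_covers[of d rk']) (use rk' d fxy in auto)
    ultimately show ?thesis
      unfolding ball using xy by (simp add: ord inj)
  qed
  with f that show thesis by blast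
qed

text \<open>The invariant that separates the posets: for \<open>x\<close> the minimum and
  \<open>a\<close> an atom, these are the other atoms sharing an upper cover with
  \<open>a\<close>.\<close>

definition partners :: "'a rel \<Rightarrow> 'a \<Rightarrow> 'a \<Rightarrow> 'a set" where
  "partners c x a = {b \<in> c `` {x}. b \<noteq> a \<and> c `` {a} \<inter> c `` {b} \<noteq> {}}"

lemma Image_digraph_iso:
  assumes "bij_betw f A B" "c \<subseteq> A \<times> A" "d \<subseteq> B \<times> B"
    and "\<And>x y. x \<in> A \<Longrightarrow> y \<in> A \<Longrightarrow> (x, y) \<in> c \<longleftrightarrow> (f x, f y) \<in> d" and "x \<in> A"
  shows "f ` (c `` {x}) = d `` {f x}"
proof -
  have "B = f ` A" using assms(1) by (simp add: bij_betw_def)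
  then show ?thesis using assms(2-5) by (auto simp: image_iff) blast+
qed

lemma partners_digraph_iso:
  assumes f: "bij_betw f A B" and c: "c \<subseteq> A \<times> A" and d: "d \<subseteq> B \<times> B"
    and e: "\<And>x y. x \<in> A \<Longrightarrow> y \<in> A \<Longrightarrow> (x, y) \<in> c \<longleftrightarrow> (f x, f y) \<in> d"
    and "x \<in> A" and a: "a \<in> A"
  shows "f ` partners c x a = partners d (f x) (f a)"
proof -
  have im: "f ` (c `` {y}) = d `` {f y}" if "y \<in> A" for y
    by (rule Image_digraph_iso[OF f c d]) (use e that in auto)
  have inj: "inj_on f A" using f by (simp add: bij_betw_def)
  have sub: "c `` {y} \<subseteq> A" for y using c by auto
  \<comment> \<open>Injectivity of \<open>f\<close> on \<open>A\<close> makes the image of the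
    intersection equal to the intersection of the images.\<close>
  have meet: "c `` {a} \<inter> c `` {b} \<noteq> {} \<longleftrightarrow> d `` {f a} \<inter> d `` {f b} \<noteq> {}" if "b \<in> A" for b
    unfolding im[OF a, symmetric] im[OF that, symmetric]
    using inj_on_image_Int[OF inj sub sub, of a b] by (metis image_is_empty)
  have ne: "b \<noteq> a \<longleftrightarrow> f b \<noteq> f a" if "b \<in> A" for b
    using inj that a by (auto simp: inj_on_def)
  have "partners d (f x) (f a) = {b \<in> f ` (c `` {x}). b \<noteq> f a \<and> d `` {f a} \<inter> d `` {b} \<noteq> {}}"
    unfolding partners_def im[OF \<open>x \<in> A\<close>] ..
  also have "\<dots> = f ` {b \<in> c `` {x}. f b \<noteq> f a \<and> d `` {f a} \<inter> d `` {f b} \<noteq> {}}" by (rule Compr_image_eq)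
  also have "{b \<in> c `` {x}. f b \<noteq> f a \<and> d `` {f a} \<inter> d `` {f b} \<noteq> {}} = partners c x a"
    unfolding partners_def using sub meet ne by blast
  finally show ?thesis by (rule sym)
qed

text \<open>Serves as index set for the atoms of both posets, so that their numbers can be compared
  through sizes of vertex sets.\<close>

definition offdiag :: "'a set \<Rightarrow> ('a \<times> 'a) set" where
  "offdiag S = {(i, j). i \<in> S \<and> j \<in> S \<and> i \<noteq> j}"

lemma finite_offdiag: "finite S \<Longrightarrow> finite (offdiag S)"
  by (rule finite_subset[of _ "S \<times> S"]) (auto simp: offdiag_def)

lemma card_offdiag:
  assumes "finite S"
  shows "card (offdiag S) = card S * card S - card S"
proof -
  have "offdiag S = S \<times> S - (\<lambda>x. (x, x)) ` S" by (auto simp: offdiag_def)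
  moreover have "card ((\<lambda>x. (x, x)) ` S) = card S" by (rule card_image) (simp add: inj_on_def)
  ultimately show ?thesis
    using assms by (subst \<open>offdiag S = _\<close>, subst card_Diff_subset) (auto simp: card_cartesian_product)
qed

section \<open>Rooted forests of height at most one\<close>

lemma SF_cover_rank:
  assumes "(F, F') \<in> SF_cover n"
  shows "card (snd F) = Suc (card (snd F'))"
proof -
  obtain s where "s \<in> snd F" "snd F' = snd F - {s}" "snd F \<subseteq> {1..n}"
    using assms unfolding SF_cover_def rooted_spanning_forests_def by auto
  then show ?thesis
    by (metis card.remove finite_atLeastAtMost finite_subset)
qed

lemma SF_cover_subset: "SF_cover n \<subseteq> rooted_spanning_forests n \<times> rooted_spanning_forests n"
  by (auto simp: SF_cover_def)

lemma SF_coverI: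
  assumes "(E, R) \<in> rooted_spanning_forests n" "r \<in> R" "s \<in> R" "r \<noteq> s"
    and "(insert {r, s} E, R - {s}) \<in> rooted_spanning_forests n"
  shows "((E, R), (insert {r, s} E, R - {s})) \<in> SF_cover n"
  using assms unfolding SF_cover_def by blast

text \<open>\<open>L\<close> holds the non-roots and \<open>p\<close> their parents. Height at most
  one covers the edgeless forest, the atoms and the common upper covers built below.\<close>

definition star_forest :: "nat \<Rightarrow> nat set \<Rightarrow> (nat \<Rightarrow> nat) \<Rightarrow> rooted_forest" where
  "star_forest n L p = ((\<lambda>v. {v, p v}) ` L, {1..n} - L)"

lemma star_forest_in:
  assumes L: "L \<subseteq> {1..n}" and p: "\<And>v. v \<in> L \<Longrightarrow> p v \<in> {1..n} - L"
  shows "star_forest n L p \<in> rooted_spanning_forests n"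
proof -
  define E where "E = (\<lambda>v. {v, p v}) ` L"
  have neighbour: "y = p x" if "{x, y} \<in> E" "x \<in> L" for x y
    using that p by (auto simp: E_def doubleton_eq_iff)
  have covered: "x \<in> L \<or> y \<in> L" if "{x, y} \<in> E" for x y
    using that by (auto simp: E_def doubleton_eq_iff)
  have acyclic: False if "is_cycle E q" for q
  proof -
    have q: "3 \<le> length q" "distinct q"
      and e: "\<And>i. i < length q \<Longrightarrow> {q ! i, q ! (Suc i mod length q)} \<in> E"
      using that by (auto simp: is_cycle_def)
    have "length q > 0" using q by linarith
    then have e0: "{q ! 0, q ! 1} \<in> E" using e[of 0] q by simp
    have e1: "{q ! 1, q ! 2} \<in> E" using e[of 1] q by (simp add: numeral_2_eq_2)
    have el: "{q ! (length q - 1), q ! 0} \<in> E" using e[of "length q - 1"] \<open>length q > 0\<close> by simp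
    \<comment> \<open>The first edge of the cycle has an end in \<open>L\<close>. Both neighbours of
      that end on the cycle are its parent, which contradicts distinctness for length at least
      3.\<close>
    from covered[OF e0] show False
    proof
      assume "q ! 0 \<in> L"
      then have "q ! 1 = q ! (length q - 1)"
        using neighbour[of "q ! 0"] e0 el by (metis insert_commute)
      then show False using q nth_eq_iff_index_eq[of q 1 "length q - 1"] \<open>length q > 0\<close> by simp
    next
      assume "q ! 1 \<in> L"
      then have "q ! 0 = q ! 2"
        using neighbour[of "q ! 1"] e0 e1 by (metis insert_commute)
      then show False using q nth_eq_iff_index_eq[of q 0 2] \<open>length q > 0\<close> by simp
    qed
  qed
  \<comment> \<open>\<open>h\<close> sends a vertex to the root of its star. It is constant along
    edges, so no second root is reachable.\<close>
  define h where "h v = (if v \<in> L then p v else v)" for v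
  have step: "h x = h y" if "{x, y} \<in> E" for x y
    using that p by (auto simp: E_def doubleton_eq_iff h_def)
  have reach: "h x = h y" if "reachable E x y" for x y
    using that unfolding reachable_def by induction (auto dest: step)
  have "\<exists>!r. r \<in> {1..n} - L \<and> reachable E v r" if "v \<in> {1..n}" for v
  proof
    have "reachable E v (h v)"
      by (auto simp: reachable_def h_def E_def)
    then show "h v \<in> {1..n} - L \<and> reachable E v (h v)" using that p by (auto simp: h_def)
  next
    fix r assume "r \<in> {1..n} - L \<and> reachable E v r"
    then show "r = h v" using reach[of v r] by (auto simp: h_def)
  qed
  moreover have "card e = 2 \<and> e \<subseteq> {1..n}" if "e \<in> E" for e
  proof -
    from that obtain v where v: "v \<in> L" "e = {v, p v}" by (auto simp: E_def)
    then have "v \<noteq> p v" using p[of v] by auto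
    then show ?thesis using v p[of v] L by auto
  qed
  ultimately show ?thesis
    using acyclic unfolding rooted_spanning_forests_def star_forest_def E_def[symmetric] by auto
qed

section \<open>Atoms of the poset of rooted forests and their common upper covers\<close>

definition edge_forest :: "nat \<Rightarrow> nat \<times> nat \<Rightarrow> rooted_forest" where
  "edge_forest n = (\<lambda>(r, s). ({{r, s}}, {1..n} - {s}))"

lemma edge_forest_in:
  assumes "(r, s) \<in> offdiag {1..n}"
  shows "edge_forest n (r, s) \<in> rooted_spanning_forests n"
proof -
  have "edge_forest n (r, s) = star_forest n {s} (\<lambda>_. r)"
    by (simp add: edge_forest_def star_forest_def insert_commute)
  moreover have "star_forest n {s} (\<lambda>_. r) \<in> rooted_spanning_forests n"
    by (rule star_forest_in) (use assms in \<open>simp_all add: offdiag_def\<close>)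
  ultimately show ?thesis by simp
qed

text \<open>The missing root determines \<open>s\<close>, after which the edge determines
  \<open>r\<close>.\<close>

lemma inj_on_edge_forest: "inj_on (edge_forest n) (offdiag {1..n})"
proof (rule inj_onI, clarify)
  fix r s r' s'
  assume rs: "(r, s) \<in> offdiag {1..n}" "(r', s') \<in> offdiag {1..n}"
    and "edge_forest n (r, s) = edge_forest n (r', s')"
  then have "{r, s} = {r', s'}" "{1..n} - {s} = {1..n} - {s'}" by (auto simp: edge_forest_def)
  moreover from this(2) have "s = s'" using rs unfolding offdiag_def by blast
  ultimately show "r = r' \<and> s = s'" by (auto simp: doubleton_eq_iff)
qed

lemma SF_bot_in: "({}, {1..n}) \<in> rooted_spanning_forests n"
  using star_forest_in[of "{}" n] by (simp add: star_forest_def)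

lemma SF_covers_bot: "SF_cover n `` {({}, {1..n})} = edge_forest n ` offdiag {1..n}"
proof (intro equalityI subsetI)
  fix F assume "F \<in> SF_cover n `` {({}, {1..n})}"
  then obtain r s where "(r, s) \<in> offdiag {1..n}" "F = edge_forest n (r, s)"
    by (auto simp: SF_cover_def offdiag_def edge_forest_def)
  then show "F \<in> edge_forest n ` offdiag {1..n}" by blast
next
  fix F assume "F \<in> edge_forest n ` offdiag {1..n}"
  then obtain r s where rs: "(r, s) \<in> offdiag {1..n}" and F: "F = edge_forest n (r, s)" by auto
  show "F \<in> SF_cover n `` {({}, {1..n})}"
    using SF_coverI[OF SF_bot_in, of r n s] edge_forest_in[OF rs] rs
    by (simp add: F edge_forest_def offdiag_def)
qed

text \<open>An edge would make two distinct roots reachable from one vertex.\<close>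

lemma SF_all_roots:
  assumes "(E, {1..n}) \<in> rooted_spanning_forests n"
  shows "E = {}"
proof (rule ccontr)
  assume "E \<noteq> {}"
  then obtain e where e: "e \<in> E" by blast
  with assms have "e \<subseteq> {1..n}" "card e = 2" by (auto simp: rooted_spanning_forests_def)
  then obtain x y where xy: "e = {x, y}" "x \<noteq> y" "x \<in> {1..n}" "y \<in> {1..n}"
    by (auto simp: card_2_iff)
  have "reachable E x x" "reachable E x y" using e xy by (auto simp: reachable_def)
  then show False using assms xy unfolding rooted_spanning_forests_def by blast
qed

text \<open>An upper cover is given by an ordered pair of roots, and a forest other than the minimum
  lacks some root. This singles out the minimum by its number of upper covers.\<close>

lemma SF_covers_card:
  assumes F: "F \<in> rooted_spanning_forests n" "F \<noteq> ({}, {1..n})" and n: "n \<ge> 2"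
  shows "finite (SF_cover n `` {F})" "card (SF_cover n `` {F}) < card (offdiag {1..n})"
proof -
  obtain E R where ER: "F = (E, R)" by force
  have R: "R \<subset> {1..n}"
    using F SF_all_roots[of E n] unfolding ER rooted_spanning_forests_def by blast
  then have fin: "finite R" by (meson finite_atLeastAtMost finite_subset psubset_imp_subset)
  have sub: "SF_cover n `` {F} \<subseteq> (\<lambda>(r, s). (insert {r, s} E, R - {s})) ` offdiag R"
    by (force simp: SF_cover_def ER offdiag_def)
  show "finite (SF_cover n `` {F})"
    by (rule finite_subset[OF sub]) (simp add: finite_offdiag fin)
  have "card (SF_cover n `` {F}) \<le> card (offdiag R)"
    using surj_card_le[OF finite_offdiag[OF fin] sub] .
  also have "\<dots> < card (offdiag {1..n})"
  proof (rule psubset_card_mono)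
    from R obtain x where x: "x \<in> {1..n}" "x \<notin> R" by blast
    \<comment> \<open>As \<open>n\<close> is at least 2, there is a vertex besides the missing root
      \<open>x\<close>, hence a pair that is lost.\<close>
    obtain y where y: "y \<in> {1..n}" "y \<noteq> x"
    proof (cases "x = 1")
      case True then show thesis using that[of 2] n by simp
    next
      case False then show thesis using that[of 1] n by simp
    qed
    have "(x, y) \<in> offdiag {1..n} - offdiag R" using x y by (simp add: offdiag_def)
    moreover have "offdiag R \<subseteq> offdiag {1..n}" using R by (auto simp: offdiag_def)
    ultimately show "offdiag R \<subset> offdiag {1..n}" by blast
  qed (simp add: finite_offdiag)
  finally show "card (SF_cover n `` {F}) < card (offdiag {1..n})" .
qed

text \<open>By \<open>ne\<close>, the children \<open>s\<close> and \<open>s'\<close> differ and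
  neither is the parent of the other, so both edges together still form a forest of height one. The
  case \<open>r' = r\<close> is included.\<close>

lemma edge_forest_partner:
  assumes rs: "(r, s) \<in> offdiag {1..n}" and rs': "(r', s') \<in> offdiag {1..n}"
    and ne: "s' \<noteq> s" "s' \<noteq> r" "r' \<noteq> s"
  shows "edge_forest n (r', s') \<in> partners (SF_cover n) ({}, {1..n}) (edge_forest n (r, s))"
proof -
  define z where "z = ({{r, s}, {r', s'}}, {1..n} - {s, s'})"
  have "star_forest n {s, s'} ((\<lambda>_. r)(s' := r')) = z"
    using ne by (auto simp: star_forest_def z_def)
  moreover have "star_forest n {s, s'} ((\<lambda>_. r)(s' := r')) \<in> rooted_spanning_forests n"
    using assms by (intro star_forest_in) (auto simp: offdiag_def)
  ultimately have z: "z \<in> rooted_spanning_forests n" by simp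
  have "(edge_forest n (r, s), z) \<in> SF_cover n"
  proof -
    have "(insert {r', s'} {{r, s}}, {1..n} - {s} - {s'}) = z" unfolding z_def by blast
    then show ?thesis
      using SF_coverI[of "{{r, s}}" "{1..n} - {s}" n r' s'] z edge_forest_in[OF rs] rs' ne
      by (simp add: edge_forest_def offdiag_def)
  qed
  moreover have "(edge_forest n (r', s'), z) \<in> SF_cover n"
  proof -
    have "(insert {r, s} {{r', s'}}, {1..n} - {s'} - {s}) = z" unfolding z_def by blast
    then show ?thesis
      using SF_coverI[of "{{r', s'}}" "{1..n} - {s'}" n r s] z edge_forest_in[OF rs'] rs ne
      by (simp add: edge_forest_def offdiag_def)
  qed
  moreover have "edge_forest n (r', s') \<noteq> edge_forest n (r, s)"
    using inj_onD[OF inj_on_edge_forest _ rs' rs] ne by blast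
  moreover have "edge_forest n (r', s') \<in> SF_cover n `` {({}, {1..n})}"
    unfolding SF_covers_bot using rs' by blast
  ultimately show ?thesis unfolding partners_def by blast
qed

text \<open>All oriented edges avoiding \<open>r\<close> and \<open>s\<close> are compatible with
  the given one, and a second child \<open>t\<close> of \<open>r\<close> adds one more. Finiteness
  is assumed because \<open>card\<close> is 0 on infinite sets.\<close>

lemma SF_partners_card:
  assumes n: "n \<ge> 3" and rs: "(r, s) \<in> offdiag {1..n}"
    and fin: "finite (partners (SF_cover n) ({}, {1..n}) (edge_forest n (r, s)))"
  shows "card (offdiag ({1..n} - {r, s})) < card (partners (SF_cover n) ({}, {1..n}) (edge_forest n (r, s)))"
    (is "_ < card ?P")
proof -
  have "card ({1..n} - {r, s}) = n - 2"
    using rs by (auto simp: offdiag_def card_Diff_subset)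
  then have "{1..n} - {r, s} \<noteq> {}" using n by (metis card.empty diff_is_0_eq not_less_eq_eq numeral_2_eq_2 numeral_3_eq_3)
  then obtain t where t: "t \<in> {1..n}" "t \<noteq> r" "t \<noteq> s" by blast
  define M where "M = insert (r, t) (offdiag ({1..n} - {r, s}))"
  have M: "M \<subseteq> offdiag {1..n}" using t rs by (auto simp: M_def offdiag_def)
  have "edge_forest n ` M \<subseteq> ?P"
  proof
    fix b assume "b \<in> edge_forest n ` M"
    then obtain r' s' where m: "(r', s') \<in> M" and b: "b = edge_forest n (r', s')" by force
    have "s' \<noteq> s" "s' \<noteq> r" "r' \<noteq> s" using m t rs by (auto simp: M_def offdiag_def)
    then show "b \<in> ?P" unfolding b using edge_forest_partner[OF rs] m M by blast
  qed
  then have "card (edge_forest n ` M) \<le> card ?P" by (rule card_mono[OF fin])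
  moreover have "card (edge_forest n ` M) = card M"
    by (rule card_image) (rule inj_on_subset[OF inj_on_edge_forest M])
  moreover have "card M = Suc (card (offdiag ({1..n} - {r, s})))"
    unfolding M_def by (subst card_insert_disjoint) (auto simp: finite_offdiag, simp add: offdiag_def)
  ultimately show ?thesis by simp
qed

section \<open>Small bicolored Lyndon trees\<close>

lemma leaves_nonempty [simp]: "leaves t \<noteq> []"
  by (induction t) auto

lemma nu_Leaf [simp]: "nu (Leaf a) = a"
  by (simp add: nu_def)

lemma nu_Node [simp]: "nu (Node c l r) = min (nu l) (nu r)"
  by (simp add: nu_def Min_Un)

text \<open>Turns a condition on all internal vertices into a recursion over the tree, from which
  the simplification rules for the next two predicates follow.\<close>

lemma all_subtrees_Node:
  "(\<forall>c' l' r'. Node c' l' r' \<in> subtrees (Node c l r) \<longrightarrow> P c' l' r') \<longleftrightarrow>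
   P c l r \<and> (\<forall>c' l' r'. Node c' l' r' \<in> subtrees l \<longrightarrow> P c' l' r') \<and>
   (\<forall>c' l' r'. Node c' l' r' \<in> subtrees r \<longrightarrow> P c' l' r')"
  by (simp only: subtrees.simps insert_iff Un_iff btree.inject) blast

lemma normalized_simps [simp]:
  "normalized (Leaf a)"
  "normalized (Node c l r) \<longleftrightarrow> nu l \<le> nu r \<and> normalized l \<and> normalized r"
  by (simp add: normalized_def)
    (simp only: normalized_def all_subtrees_Node nu_Node min.absorb_iff1)

lemma bicolored_lyndon_simps [simp]:
  "bicolored_lyndon (Leaf a)"
  "bicolored_lyndon (Node c l r) \<longleftrightarrow> nu l \<le> nu r \<and> bicolored_lyndon l \<and> bicolored_lyndon r \<and>
     (case l of Leaf a \<Rightarrow> True | Node d ll lr \<Rightarrow> nu lr > nu r \<or> d > c)"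
  by (simp add: bicolored_lyndon_def)
    (simp only: bicolored_lyndon_def imp_conjL all_subtrees_Node,
      auto simp: lyndon_vertex_def split: btree.splits)

lemma merge_done: "bicolored_lyndon (Node u T1 T2) \<Longrightarrow> merge u T1 T2 = Node u T1 T2"
  by (simp add: merge_def while_unfold)

text \<open>Zero or one replacement suffices for the merges evaluated below, which involve leaves
  and at most one two-leaf tree.\<close>

lemma merge_slide_once:
  "\<not> bicolored_lyndon (Node u T1 T2) \<Longrightarrow> bicolored_lyndon (slide 0 (Node u T1 T2)) \<Longrightarrow>
   merge u T1 T2 = slide 0 (Node u T1 T2)"
  by (simp add: merge_def while_unfold del: bicolored_lyndon_simps)

lemma leaves_subtree: "s \<in> subtrees t \<Longrightarrow> set (leaves s) \<subseteq> set (leaves t)"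
  by (induction t) auto

lemma distinct_leaves_subtree: "s \<in> subtrees t \<Longrightarrow> distinct (leaves t) \<Longrightarrow> distinct (leaves s)"
  by (induction t) auto

lemma subtree_refl [simp]: "t \<in> subtrees t"
  by (cases t) auto

text \<open>The label \<open>a\<close> occurs below just one of the two children, so its parent is
  unique. This allows parents found by two different merges to be identified.\<close>

lemma right_leaf_unique:
  assumes "distinct (leaves t)" "Node c l (Leaf a) \<in> subtrees t" "Node c' l' (Leaf a) \<in> subtrees t"
  shows "c = c' \<and> l = l'"
  using assms by (induction t) (force dest: leaves_subtree)+

lemma left_right_leaf:
  assumes "distinct (leaves t)" "Node c (Leaf a) r \<in> subtrees t" "Node c' l' (Leaf a) \<in> subtrees t"
  shows False
  using assms by (induction t) (force dest: leaves_subtree)+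

lemma singleton_leaves:
  assumes "distinct (leaves t)" "set (leaves t) \<subseteq> {a}"
  shows "t = Leaf a"
proof (cases t)
  case (Node c l r)
  then have "set (leaves l) = {a}" "set (leaves r) = {a}"
    using assms(2) by (auto simp: subset_singleton_iff Un_singleton_iff)
  then show ?thesis using assms(1) Node by simp
qed (use assms in auto)

section \<open>Atoms of the poset of bicolored Lyndon forests\<close>

lemma FLyn_cover_subset: "FLyn_cover n \<subseteq> lyndon_forests n \<times> lyndon_forests n"
  by (auto simp: FLyn_cover_def)

text \<open>The merged tree must be new: otherwise the labels of \<open>T1\<close> would occur
  nowhere in \<open>F'\<close>, whose trees still use every label.\<close>

lemma FLyn_cover_rank:
  assumes "(F, F') \<in> FLyn_cover n"
  shows "card F = Suc (card F')"
proof -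
  from assms obtain T1 T2 T where T: "T1 \<in> F" "T2 \<in> F" "T1 \<noteq> T2"
    and F': "F' = insert T (F - {T1, T2})"
    and F: "F \<in> bicolored_binary_forests n" and F'in: "F' \<in> bicolored_binary_forests n"
    unfolding FLyn_cover_def lyndon_forests_def by blast
  have fin: "finite F" using F by (simp add: bicolored_binary_forests_def)
  have "T \<notin> F - {T1, T2}"
  proof
    assume "T \<in> F - {T1, T2}"
    then have eq: "F' = F - {T1, T2}" using F' by blast
    define a where "a = hd (leaves T1)"
    have a: "a \<in> set (leaves T1)" by (simp add: a_def)
    then have "a \<in> {1..n}" using F T unfolding bicolored_binary_forests_def by blast
    then obtain T' where T': "T' \<in> F'" "a \<in> set (leaves T')"
      using F'in unfolding bicolored_binary_forests_def by blast
    then have "T' \<in> F" "T' \<noteq> T1" unfolding eq by auto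
    then have "set (leaves T') \<inter> set (leaves T1) = {}"
      using F T by (auto simp: bicolored_binary_forests_def disjoint_family_on_def)
    with a T' show False by blast
  qed
  moreover have "card (F - {T1, T2}) = card F - 2" using fin T by (simp add: card_Diff_subset)
  moreover have "2 \<le> card F" using fin T card_mono[of F "{T1, T2}"] by simp
  ultimately show ?thesis using fin F' by simp
qed

lemma Leaf_forest_in: "Leaf ` {1..n} \<in> lyndon_forests n"
  by (auto simp: lyndon_forests_def bicolored_binary_forests_def disjoint_family_on_def)

definition pair_forest :: "nat \<Rightarrow> bool \<Rightarrow> nat \<Rightarrow> nat \<Rightarrow> btree set" where
  "pair_forest n c i j = insert (Node c (Leaf i) (Leaf j)) (Leaf ` ({1..n} - {i, j}))"

lemma pair_forest_in:
  assumes "i \<in> {1..n}" "j \<in> {1..n}" "i < j"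
  shows "pair_forest n c i j \<in> lyndon_forests n"
  using assms
  by (auto simp: lyndon_forests_def bicolored_binary_forests_def disjoint_family_on_def
      pair_forest_def)

text \<open>A leaf as left child makes the new root Lyndon, so merging two leaves performs no
  replacement.\<close>

lemma FLyn_covers_bot:
  "FLyn_cover n `` {Leaf ` {1..n}} = {pair_forest n c i j | c i j. i \<in> {1..n} \<and> j \<in> {1..n} \<and> i < j}"
proof -
  have eq: "insert (merge c (Leaf i) (Leaf j)) (Leaf ` {1..n} - {Leaf i, Leaf j}) = pair_forest n c i j"
    if "i < j" for c i j
    using that by (subst merge_done) (auto simp: pair_forest_def)
  show ?thesis
  proof (intro equalityI subsetI)
    fix F assume "F \<in> FLyn_cover n `` {Leaf ` {1..n}}"
    then obtain i j u where "i \<in> {1..n}" "j \<in> {1..n}" "i < j"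
      "F = insert (merge u (Leaf i) (Leaf j)) (Leaf ` {1..n} - {Leaf i, Leaf j})"
      unfolding FLyn_cover_def by auto
    then show "F \<in> {pair_forest n c i j | c i j. i \<in> {1..n} \<and> j \<in> {1..n} \<and> i < j}"
      using eq by blast
  next
    fix F assume "F \<in> {pair_forest n c i j | c i j. i \<in> {1..n} \<and> j \<in> {1..n} \<and> i < j}"
    then obtain c i j where ij: "i \<in> {1..n}" "j \<in> {1..n}" "i < j" and F: "F = pair_forest n c i j"
      by blast
    have "Leaf i \<in> Leaf ` {1..n}" "Leaf j \<in> Leaf ` {1..n}" "nu (Leaf i) < nu (Leaf j)"
      using ij by auto
    then have "(Leaf ` {1..n}, F) \<in> FLyn_cover n"
      using Leaf_forest_in[of n] pair_forest_in[OF ij, of c] eq[OF ij(3), of c]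
      unfolding FLyn_cover_def F by blast
    then show "F \<in> FLyn_cover n `` {Leaf ` {1..n}}" by blast
  qed
qed

text \<open>The color of a pair is encoded in the order of its two labels.\<close>

definition pair_of :: "nat \<Rightarrow> nat \<times> nat \<Rightarrow> btree set" where
  "pair_of n = (\<lambda>(i, j). pair_forest n (i < j) (min i j) (max i j))"

text \<open>The one tree with an internal vertex reveals both labels and the color, and the color
  reveals their order in the pair.\<close>

lemma inj_on_pair_of: "inj_on (pair_of n) A"
proof (rule inj_onI)
  fix p q assume eq: "pair_of n p = pair_of n q"
  obtain i j k l where p: "p = (i, j)" and q: "q = (k, l)" by force
  have "Node (i < j) (Leaf (min i j)) (Leaf (max i j)) \<in> pair_of n q"
    unfolding eq[symmetric] by (simp add: p pair_of_def pair_forest_def)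
  then have "(i < j) = (k < l)" "min i j = min k l" "max i j = max k l"
    by (auto simp: q pair_of_def pair_forest_def)
  then have "i = k \<and> j = l" by (cases "i < j") (simp_all add: min_def max_def split: if_splits)
  then show "p = q" by (simp add: p q)
qed

lemma pair_of_covers_bot: "pair_of n ` offdiag {1..n} \<subseteq> FLyn_cover n `` {Leaf ` {1..n}}"
proof (rule image_subsetI, clarify)
  fix i j assume "(i, j) \<in> offdiag {1..n}"
  then have "min i j \<in> {1..n}" "max i j \<in> {1..n}" "min i j < max i j"
    by (auto simp: offdiag_def)
  then have "pair_of n (i, j) \<in> FLyn_cover n `` {Leaf ` {1..n}}"
    unfolding FLyn_covers_bot pair_of_def prod.case by blast
  then show "(Leaf ` {1..n}, pair_of n (i, j)) \<in> FLyn_cover n" by blast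
qed

lemma pair_forest_eq_pair_of:
  assumes "i \<in> S" "j \<in> S" "i < j"
  shows "pair_forest n c i j \<in> pair_of n ` offdiag S"
proof -
  \<comment> \<open>Color \<open>True\<close> comes from the increasing pair, \<open>False\<close>
    from the decreasing one.\<close>
  have "pair_forest n c i j = pair_of n (if c then (i, j) else (j, i))"
    using assms(3) by (simp add: pair_of_def)
  moreover have "(if c then (i, j) else (j, i)) \<in> offdiag S"
    using assms by (simp add: offdiag_def)
  ultimately show ?thesis by blast
qed

text \<open>A replacement keeps the color of the parent of \<open>j\<close> and the smallest label below it.\<close>

lemma pair_forest_cover:
  assumes ij: "i < j" and z: "(pair_forest n c i j, z) \<in> FLyn_cover n"
  obtains T l where "T \<in> z" "Node c l (Leaf j) \<in> subtrees T" "nu l = i"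
proof -
  let ?A = "Node c (Leaf i) (Leaf j)"
  obtain T1 T2 u where T: "T1 \<in> pair_forest n c i j" "T2 \<in> pair_forest n c i j" "nu T1 < nu T2"
    and zeq: "z = insert (merge u T1 T2) (pair_forest n c i j - {T1, T2})"
    using z unfolding FLyn_cover_def by blast
  \<comment> \<open>The two-leaf tree takes no part in the merge, is its right tree, or is its left
    tree; a replacement of interest can occur only in the last case.\<close>
  consider "T1 \<noteq> ?A" "T2 \<noteq> ?A"
    | a where "T1 = Leaf a" "T2 = ?A"
    | k where "T1 = ?A" "T2 = Leaf k" "k \<noteq> i" "k \<noteq> j"
    using T unfolding pair_forest_def by auto
  then show thesis
  proof cases
    case 1
    then have "?A \<in> z" by (simp add: zeq pair_forest_def)
    then show thesis using that[of ?A "Leaf i"] by simp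
  next
    case 2
    then have "merge u T1 T2 = Node u (Leaf a) ?A" using T ij by (subst merge_done) auto
    then have "Node u (Leaf a) ?A \<in> z" by (simp add: zeq)
    then show thesis using that[of "Node u (Leaf a) ?A" "Leaf i"] by simp
  next
    case 3
    have ik: "i < k" using T 3 ij by simp
    show thesis
    proof (cases "bicolored_lyndon (Node u ?A (Leaf k))")
      case True
      then have "Node u ?A (Leaf k) \<in> z" using merge_done[OF True] 3 by (simp add: zeq)
      then show thesis using that[of "Node u ?A (Leaf k)" "Leaf i"] by simp
    next
      case False
      \<comment> \<open>Failure excludes \<open>k < j\<close>. After one replacement the root of
        color \<open>c\<close> compares \<open>k\<close> with the smaller \<open>j\<close>, so it is
        Lyndon and the loop ends.\<close>
      then have "j < k" using ij ik 3 by auto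
      then have "merge u T1 T2 = Node c (Node u (Leaf i) (Leaf k)) (Leaf j)"
        using merge_slide_once[OF False] ij ik 3 by simp
      then have "Node c (Node u (Leaf i) (Leaf k)) (Leaf j) \<in> z" by (simp add: zeq)
      then show thesis
        using that[of "Node c (Node u (Leaf i) (Leaf k)) (Leaf j)" "Node u (Leaf i) (Leaf k)"] ik
        by simp
    qed
  qed
qed

text \<open>The two largest labels leave no room: in a common upper cover they are sibling leaves
  below a vertex of color 0, which excludes any partner whose larger label is \<open>n - 1\<close>
  or \<open>n\<close>.\<close>

lemma FLyn_partners_subset:
  assumes n: "n \<ge> 2"
  shows "partners (FLyn_cover n) (Leaf ` {1..n}) (pair_forest n False (n - 1) n)
         \<subseteq> pair_of n ` offdiag ({1..n} - {n - 1, n})"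
proof
  let ?a = "pair_forest n False (n - 1) n"
  fix b assume "b \<in> partners (FLyn_cover n) (Leaf ` {1..n}) ?a"
  then obtain c i j z where b: "b = pair_forest n c i j" and ij: "i \<in> {1..n}" "j \<in> {1..n}" "i < j"
    and ne: "b \<noteq> ?a" and az: "(?a, z) \<in> FLyn_cover n" and bz: "(b, z) \<in> FLyn_cover n"
    unfolding partners_def FLyn_covers_bot by blast
  from az have "z \<in> bicolored_binary_forests n"
    unfolding FLyn_cover_def lyndon_forests_def by blast
  then have dist: "\<And>T. T \<in> z \<Longrightarrow> distinct (leaves T)"
    and disj: "\<And>T T' x. T \<in> z \<Longrightarrow> T' \<in> z \<Longrightarrow> x \<in> set (leaves T) \<Longrightarrow> x \<in> set (leaves T') \<Longrightarrow> T = T'"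
    and range: "\<And>T. T \<in> z \<Longrightarrow> set (leaves T) \<subseteq> {1..n}"
    unfolding bicolored_binary_forests_def disjoint_family_on_def by blast+
  obtain T l where T: "T \<in> z" "Node False l (Leaf n) \<in> subtrees T" "nu l = n - 1"
    using pair_forest_cover[OF _ az] n by auto
  obtain T' l' where T': "T' \<in> z" "Node c l' (Leaf j) \<in> subtrees T'" "nu l' = i"
    using pair_forest_cover[OF ij(3) bz[unfolded b]] by blast
  have leaf_j: "j \<in> set (leaves T')" using leaves_subtree[OF T'(2)] by simp
  have dl: "distinct (leaves l)" "n \<notin> set (leaves l)"
    using distinct_leaves_subtree[OF T(2) dist[OF T(1)]] by auto
  \<comment> \<open>The labels below \<open>l\<close> are at least \<open>n - 1\<close>, and
    \<open>n\<close> is already taken by the right child.\<close>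
  have "set (leaves l) \<subseteq> {n - 1}"
  proof
    fix x assume x: "x \<in> set (leaves l)"
    then have "n - 1 \<le> x" using T(3) Min_le[of "set (leaves l)" x] by (simp add: nu_def)
    moreover have "x \<le> n" using x leaves_subtree[OF T(2)] range[OF T(1)] by auto
    moreover have "x \<noteq> n" using x dl by blast
    ultimately show "x \<in> {n - 1}" by simp
  qed
  then have l: "l = Leaf (n - 1)" using singleton_leaves dl by blast
  have leaf_T: "n \<in> set (leaves T)" "n - 1 \<in> set (leaves T)" using leaves_subtree[OF T(2)] l by auto
  \<comment> \<open>The leaf \<open>n\<close> has one parent in \<open>z\<close>, so both atoms
    would have the same color and the same smaller label, making \<open>b\<close> equal to
    \<open>?a\<close>.\<close>
  have "j \<noteq> n"
  proof
    assume j: "j = n"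
    then have "T' = T" using disj T T' leaf_j leaf_T by blast
    then have "c = False" "l' = l" using right_leaf_unique[OF dist[OF T(1)] T(2)] T' j by auto
    then show False using ne b T T' j by simp
  qed
  \<comment> \<open>Here \<open>n - 1\<close> would be both a left child, as the sibling of
    \<open>n\<close>, and a right child.\<close>
  moreover have "j \<noteq> n - 1"
  proof
    assume j: "j = n - 1"
    then have "T' = T" using disj T T' leaf_j leaf_T by blast
    then show False using left_right_leaf[OF dist[OF T(1)]] T(2) T'(2) l j by blast
  qed
  ultimately show "b \<in> pair_of n ` offdiag ({1..n} - {n - 1, n})"
    unfolding b using ij by (intro pair_forest_eq_pair_of) auto
qed

section \<open>Contradiction from counting common upper covers\<close>

theorem theorem5p6:
  fixes n :: nat
  assumes "n \<ge> 3"
  shows "\<not> poset_isomorphic (lyndon_forests n) (FLyn_order n)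
                            (rooted_spanning_forests n) (SF_order n)"
proof
  assume iso: "poset_isomorphic (lyndon_forests n) (FLyn_order n)
                                (rooted_spanning_forests n) (SF_order n)"
  obtain f where f: "bij_betw f (lyndon_forests n) (rooted_spanning_forests n)"
    and fc: "\<And>x y. x \<in> lyndon_forests n \<Longrightarrow> y \<in> lyndon_forests n \<Longrightarrow>
      (x, y) \<in> FLyn_cover n \<longleftrightarrow> (f x, f y) \<in> SF_cover n"
    using poset_isomorphic_covers[of "FLyn_cover n" card "lyndon_forests n" "SF_cover n"
        "\<lambda>F. card (snd F)" "rooted_spanning_forests n" thesis, OF _ FLyn_cover_subset _
        SF_cover_subset iso[unfolded FLyn_order_def SF_order_def]]
      FLyn_cover_rank SF_cover_rank by blast
  have inj: "inj_on f (lyndon_forests n)" using f by (simp add: bij_betw_def)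
  define bot where "bot = Leaf ` {1..n}"
  define a where "a = pair_forest n False (n - 1) n"
  have bot: "bot \<in> lyndon_forests n" unfolding bot_def by (rule Leaf_forest_in)
  have a: "a \<in> lyndon_forests n" unfolding a_def using assms by (intro pair_forest_in) auto
  have im: "f ` (FLyn_cover n `` {bot}) = SF_cover n `` {f bot}"
    by (rule Image_digraph_iso[OF f FLyn_cover_subset SF_cover_subset fc bot])
  have sub: "FLyn_cover n `` {bot} \<subseteq> lyndon_forests n" using FLyn_cover_subset by blast
  \<comment> \<open>\<open>bot\<close> has at least n(n - 1) upper covers, more than any rooted
    forest with an edge.\<close>
  have fbot: "f bot = ({}, {1..n})"
  proof (rule ccontr)
    assume ne: "f bot \<noteq> ({}, {1..n})"
    have "f bot \<in> rooted_spanning_forests n" using f bot by (auto simp: bij_betw_def)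
    note small = SF_covers_card[OF this ne]
    have card: "card (FLyn_cover n `` {bot}) = card (SF_cover n `` {f bot})"
      unfolding im[symmetric] by (rule card_image[OF inj_on_subset[OF inj sub], symmetric])
    \<comment> \<open>Finiteness is pulled back along \<open>f\<close> from the rooted forests, so
      that \<open>card_mono\<close> applies.\<close>
    have "finite (FLyn_cover n `` {bot})"
      using small(1) assms inj_on_subset[OF inj sub] unfolding im[symmetric]
      by (simp add: finite_image_iff)
    then have "card (pair_of n ` offdiag {1..n}) \<le> card (FLyn_cover n `` {bot})"
      unfolding bot_def by (rule card_mono[OF _ pair_of_covers_bot])
    moreover have "card (pair_of n ` offdiag {1..n}) = card (offdiag {1..n})"
      by (rule card_image[OF inj_on_pair_of])
    ultimately show False using small(2) assms card by simp
  qed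
  have "a \<in> FLyn_cover n `` {bot}"
    unfolding a_def bot_def FLyn_covers_bot using assms by fastforce
  then have "f a \<in> edge_forest n ` offdiag {1..n}"
    using im unfolding fbot SF_covers_bot by blast
  then obtain r s where rs: "(r, s) \<in> offdiag {1..n}" and fa: "f a = edge_forest n (r, s)" by force
  let ?P = "partners (FLyn_cover n) bot a"
  have P: "f ` ?P = partners (SF_cover n) ({}, {1..n}) (edge_forest n (r, s))"
    using partners_digraph_iso[OF f FLyn_cover_subset SF_cover_subset fc bot a]
    unfolding fbot fa .
  have Psub: "?P \<subseteq> pair_of n ` offdiag ({1..n} - {n - 1, n})"
    unfolding bot_def a_def using assms by (intro FLyn_partners_subset) simp
  then have finP: "finite ?P" by (rule finite_subset) (simp add: finite_offdiag)
  \<comment> \<open>The rooted side yields more than (n - 2)(n - 3) partners, the Lyndon side at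
    most that many.\<close>
  have "card (offdiag ({1..n} - {r, s})) < card (f ` ?P)"
    using SF_partners_card[OF assms rs] finP unfolding P[symmetric] by simp
  also have "\<dots> \<le> card ?P" by (rule card_image_le[OF finP])
  also have "\<dots> \<le> card (offdiag ({1..n} - {n - 1, n}))"
    by (rule surj_card_le[OF _ Psub]) (simp add: finite_offdiag)
  \<comment> \<open>Both vertex sets omit two distinct labels, so each has n - 2 elements.\<close>
  also have "\<dots> = card (offdiag ({1..n} - {r, s}))"
  proof -
    have "card ({1..n} - {n - 1, n}) = n - 2" using assms by (simp add: card_Diff_subset)
    moreover have "card ({1..n} - {r, s}) = n - 2"
      using rs by (auto simp: offdiag_def card_Diff_subset)
    ultimately show ?thesis by (simp add: card_offdiag)
  qed
  finally show False by simp
qed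

end
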